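(* The set $S = \{u_0,u_1,u_2,u_3,u_4,u_5,u_6\}$ is a zero forcing set of the generalized Petersen graph $P(12,3)$. Hence $Z(P(12,3)) \le 7$.
   Context: Let $G=(V,E)$ be a finite simple graph. Color a subset $S\subseteq V$ black and the remaining vertices white. Color change rule: a black vertex with exactly one white neighbor forces that neighbor to become black. Iterating this rule starting from $S$ until no further force is possible gives the closure $\mathrm{cl}(S)$. The set $S$ is a zero forcing set of $G$ if $\mathrm{cl}(S)=V$, and the zero forcing number $Z(G)$ is the minimum cardinality of a zero forcing set. For $n\ge 3$ and $1\le k<n/2$, the generalized Petersen graph $P(n,k)$ has the $2n$ vertices $\{u_0,\dots,u_{n-1}\}\cup\{v_0,\dots,v_{n-1}\}$ and edges $u_i\sim u_{i+1}$, $u_i\sim v_i$, and $v_i\sim v_{i+k}$ for all $i$, with indices taken modulo $n$. *)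

theory Defs
  imports "Graph_Theory.Pair_Digraph"
begin

text \<open>
  A finite simple graph is an instance of \<^locale>\<open>pair_graph\<close>: a finite loop-free digraph without
  parallel arcs whose arc relation is symmetric, an undirected edge being a pair of opposite arcs.
\<close>

definition white_neighbours :: "'a pair_pre_digraph \<Rightarrow> 'a set \<Rightarrow> 'a \<Rightarrow> 'a set" where
  "white_neighbours G B u = {v. (u, v) \<in> parcs G \<and> v \<notin> B}"

definition force_step :: "'a pair_pre_digraph \<Rightarrow> 'a set \<Rightarrow> 'a set \<Rightarrow> bool" where
  "force_step G B B' \<longleftrightarrow> (\<exists>u\<in>B. \<exists>v. white_neighbours G B u = {v} \<and> B' = insert v B)"

text \<open>
  Forces are applied one at a time, in any order, until none is possible; the final black set
  does not depend on the order (\<open>ex1_forcing_result\<close> below).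
\<close>

definition forcing_closure :: "'a pair_pre_digraph \<Rightarrow> 'a set \<Rightarrow> 'a set" where
  "forcing_closure G S = (THE C. (force_step G)\<^sup>*\<^sup>* S C \<and> (\<nexists>D. force_step G C D))"

definition zero_forcing_set :: "'a pair_pre_digraph \<Rightarrow> 'a set \<Rightarrow> bool" where
  "zero_forcing_set G S \<longleftrightarrow> S \<subseteq> pverts G \<and> forcing_closure G S = pverts G"

definition zero_forcing_number :: "'a pair_pre_digraph \<Rightarrow> nat" where
  "zero_forcing_number G = Min (card ` {S. zero_forcing_set G S})"

text \<open>\<open>Outer i\<close> is the vertex $u_i$ and \<open>Inner i\<close> is the vertex $v_i$.\<close>

datatype petersen_vertex = Outer nat | Inner nat

definition petersen_half_arcs :: "nat \<Rightarrow> nat \<Rightarrow> petersen_vertex rel" where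
  "petersen_half_arcs n k =
     {(Outer i, Outer ((i + 1) mod n)) | i. i < n} \<union>
     {(Outer i, Inner i) | i. i < n} \<union>
     {(Inner i, Inner ((i + k) mod n)) | i. i < n}"

definition generalized_petersen :: "nat \<Rightarrow> nat \<Rightarrow> petersen_vertex pair_pre_digraph" where
  "generalized_petersen n k =
     \<lparr> pverts = Outer ` {..<n} \<union> Inner ` {..<n},
       parcs = petersen_half_arcs n k \<union> (petersen_half_arcs n k)\<inverse> \<rparr>"

lemma force_step_subset_stable:
  assumes "(force_step G)\<^sup>*\<^sup>* S B" "S \<subseteq> T" "\<nexists>D. force_step G T D"
  shows "B \<subseteq> T"
  using assms(1)
proof (induction rule: rtranclp_induct)
  case base
  show ?case by (fact assms(2))
next
  case (step B B')
  obtain u v where uv: "u \<in> B" "white_neighbours G B u = {v}" "B' = insert v B"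
    using step.hyps(2) by (auto simp: force_step_def)
  have "v \<in> T"
  proof (rule ccontr)
    assume "v \<notin> T"
    hence "white_neighbours G T u = {v}"
      using uv(2) step.IH unfolding white_neighbours_def by blast
    hence "force_step G T (insert v T)"
      using uv(1) step.IH unfolding force_step_def by blast
    thus False using assms(3) by blast
  qed
  thus ?case using uv(3) step.IH by blast
qed

lemma force_steps_mono: "(force_step G)\<^sup>*\<^sup>* S B \<Longrightarrow> S \<subseteq> B"
  by (induction rule: rtranclp_induct) (auto simp: force_step_def)

lemma (in pair_fin_digraph) ex_forcing_result:
  "\<exists>C. (force_step G)\<^sup>*\<^sup>* S C \<and> (\<nexists>D. force_step G C D)"
proof (induction "card (pverts G - S)" arbitrary: S rule: less_induct)
  case less
  show ?case
  proof (cases "\<exists>D. force_step G S D")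
    case False
    thus ?thesis by blast
  next
    case True
    then obtain u v where uv: "white_neighbours G S u = {v}"
      "force_step G S (insert v S)" by (auto simp: force_step_def)
    have "v \<in> pverts G - S"
      using uv(1) in_arcsD2 unfolding white_neighbours_def by blast
    hence "card (pverts G - insert v S) < card (pverts G - S)"
      using pair_finite_verts by (intro psubset_card_mono) auto
    from less[OF this] uv(2) show ?thesis
      by (meson converse_rtranclp_into_rtranclp)
  qed
qed

lemma (in pair_fin_digraph) ex1_forcing_result:
  "\<exists>!C. (force_step G)\<^sup>*\<^sup>* S C \<and> (\<nexists>D. force_step G C D)"
proof (rule ex_ex1I)
  show "\<exists>C. (force_step G)\<^sup>*\<^sup>* S C \<and> (\<nexists>D. force_step G C D)" by (rule ex_forcing_result)
next
  fix C D
  assume "(force_step G)\<^sup>*\<^sup>* S C \<and> (\<nexists>E. force_step G C E)"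
    and "(force_step G)\<^sup>*\<^sup>* S D \<and> (\<nexists>E. force_step G D E)"
  thus "C = D"
    using force_step_subset_stable force_steps_mono by (metis subset_antisym)
qed

lemma (in pair_fin_digraph) zero_forcing_set_pverts: "zero_forcing_set G (pverts G)"
proof -
  have "\<nexists>D. force_step G (pverts G) D"
  proof
    assume "\<exists>D. force_step G (pverts G) D"
    then obtain u v where "white_neighbours G (pverts G) u = {v}"
      by (auto simp: force_step_def)
    thus False using in_arcsD2 unfolding white_neighbours_def by blast
  qed
  hence "forcing_closure G (pverts G) = pverts G"
    unfolding forcing_closure_def by (intro the1_equality ex1_forcing_result) auto
  thus ?thesis by (simp add: zero_forcing_set_def)
qed

lemma (in pair_fin_digraph) finite_zero_forcing_sets: "finite {S. zero_forcing_set G S}"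
  by (rule finite_subset[of _ "Pow (pverts G)"])
    (auto simp: zero_forcing_set_def pair_finite_verts)

lemma pair_graph_generalized_petersen:
  assumes "n \<ge> 3" "1 \<le> k" "2 * k < n"
  shows "pair_graph (generalized_petersen n k)"
proof -
  have mod_ne: "(i + j) mod n \<noteq> i" if "i < n" "0 < j" "j < n" for i j
    using that by (cases "i + j < n") (auto simp: mod_if)
  have fin: "finite (petersen_half_arcs n k)"
    unfolding petersen_half_arcs_def by simp
  show ?thesis
  proof unfold_locales
    fix e assume e: "e \<in> parcs (generalized_petersen n k)"
    show "fst e \<in> pverts (generalized_petersen n k)"
      using e assms by (auto simp: generalized_petersen_def petersen_half_arcs_def)
    show "snd e \<in> pverts (generalized_petersen n k)"
      using e assms by (auto simp: generalized_petersen_def petersen_half_arcs_def)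
    show "fst e \<noteq> snd e"
      using e assms mod_ne[of _ 1] mod_ne[of _ k]
      by (fastforce simp: generalized_petersen_def petersen_half_arcs_def)
  next
    show "finite (pverts (generalized_petersen n k))"
      by (simp add: generalized_petersen_def)
    show "finite (parcs (generalized_petersen n k))"
      using fin by (simp add: generalized_petersen_def)
    show "symmetric (with_proj (generalized_petersen n k))"
      by (auto simp: symmetric_def generalized_petersen_def sym_def)
  qed
qed

end

theory Submission
  imports Defs
begin

text \<open>
  The outer vertices $u_1,\dots,u_5$ force $v_1,\dots,v_5$; along the inner cycles these force
  $v_{10}, v_{11}, v_7, v_8$, which in turn force $u_{10}, u_{11}, u_7, u_8$. Finally $u_0$, $u_6$
  and $u_8$ force $v_0$, $v_6$ and $u_9$, and $v_6$ forces $v_9$.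
\<close>

text \<open>If \<open>v\<close> were white, it would be the only white neighbour of
  \<open>u\<close>, so \<open>u\<close> could still force it, against stability. This turns each
  force into a membership fact about a fixed stable set, so that no sequence of black sets has to be
  tracked.\<close>

lemma force_stableD:
  assumes "\<nexists>D. force_step G C D" "u \<in> C" "(u, v) \<in> parcs G"
    "\<And>w. (u, w) \<in> parcs G \<Longrightarrow> w = v \<or> w \<in> C"
  shows "v \<in> C"
proof (rule ccontr)
  assume "v \<notin> C"
  hence "white_neighbours G C u = {v}"
    using assms(3,4) unfolding white_neighbours_def by blast
  thus False using assms(1,2) unfolding force_step_def by blast
qed

text \<open>The closure is itself a stable superset of \<open>S\<close>, so the second assumption
  applies to it. It cannot leave the vertex set, because \<open>pverts G\<close> is stable
  too.\<close>

lemma (in pair_fin_digraph) zero_forcing_setI: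
  assumes "S \<subseteq> pverts G" "\<And>C. S \<subseteq> C \<Longrightarrow> \<nexists>D. force_step G C D \<Longrightarrow> pverts G \<subseteq> C"
  shows "zero_forcing_set G S"
proof -
  let ?C = "forcing_closure G S"
  \<comment> \<open>Existence and uniqueness of the final black set make the definite description in
    \<open>forcing_closure\<close> meaningful.\<close>
  have C: "(force_step G)\<^sup>*\<^sup>* S ?C" "\<nexists>D. force_step G ?C D"
    using theI'[OF ex1_forcing_result[of S]] unfolding forcing_closure_def by auto
  have "\<nexists>D. force_step G (pverts G) D"
    using in_arcsD2 unfolding force_step_def white_neighbours_def by blast
  hence "?C \<subseteq> pverts G" using force_step_subset_stable[OF C(1) assms(1)] by blast
  moreover have "pverts G \<subseteq> ?C" using assms(2) force_steps_mono[OF C(1)] C(2) by blast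
  ultimately show ?thesis using assms(1) unfolding zero_forcing_set_def by blast
qed

lemma (in pair_fin_digraph) zero_forcing_number_le_card:
  "zero_forcing_set G S \<Longrightarrow> zero_forcing_number G \<le> card S"
  unfolding zero_forcing_number_def using finite_zero_forcing_sets by (intro Min_le) auto

text \<open>Inverts the rotation by \<open>k\<close>, which yields the neighbours that come from
  converse half arcs. Writing \<open>i + n - k\<close> avoids truncated subtraction when
  \<open>i < k\<close>.\<close>

lemma eq_add_mod_iff:
  fixes i j k n :: nat
  assumes "i < n" "j < n" "k \<le> n"
  shows "i = (j + k) mod n \<longleftrightarrow> j = (i + n - k) mod n"
  using assms by (cases "j + k < n"; cases "k \<le> i") (auto simp: mod_if)

lemma parcs_generalized_petersen_Outer:
  assumes "i < n"
  shows "(Outer i, w) \<in> parcs (generalized_petersen n k) \<longleftrightarrow>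
    w \<in> {Outer ((i + 1) mod n), Outer ((i + n - 1) mod n), Inner i}"
proof -
  have "0 < n" "1 \<le> n" using assms by auto
  thus ?thesis using assms eq_add_mod_iff[of i n _ 1]
    by (cases w) (auto simp: generalized_petersen_def petersen_half_arcs_def)
qed

lemma parcs_generalized_petersen_Inner:
  assumes "i < n" "k \<le> n"
  shows "(Inner i, w) \<in> parcs (generalized_petersen n k) \<longleftrightarrow>
    w \<in> {Inner ((i + k) mod n), Inner ((i + n - k) mod n), Outer i}"
proof -
  have "0 < n" using assms by auto
  thus ?thesis using assms eq_add_mod_iff[of i n _ k]
    by (cases w) (auto simp: generalized_petersen_def petersen_half_arcs_def)
qed

theorem lemma2:
  shows "zero_forcing_set (generalized_petersen 12 3)
           {Outer 0, Outer 1, Outer 2, Outer 3, Outer 4, Outer 5, Outer 6}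
       \<and> zero_forcing_number (generalized_petersen 12 3) \<le> 7"
proof -
  let ?G = "generalized_petersen 12 3"
  let ?S = "{Outer 0, Outer 1, Outer 2, Outer 3, Outer 4, Outer 5, Outer 6}"
  interpret pair_graph ?G by (rule pair_graph_generalized_petersen) auto
  have verts: "pverts ?G = Outer ` {..<12} \<union> Inner ` {..<12}"
    by (simp add: generalized_petersen_def)
  have "zero_forcing_set ?G ?S"
  proof (rule zero_forcing_setI)
    show "?S \<subseteq> pverts ?G" by (auto simp: verts)
  next
    fix C assume S: "?S \<subseteq> C" and stable: "\<nexists>D. force_step ?G C D"
    note force = force_stableD[OF stable]
    \<comment> \<open>The simplifier can turn the index \<open>1 + 1\<close> into
      \<open>Suc (Suc 0)\<close>; the last rule restores the numeral \<open>2\<close>.\<close>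
    note arcs = parcs_generalized_petersen_Outer parcs_generalized_petersen_Inner
      numeral_2_eq_2[symmetric]
    have u0_6: "Outer 0 \<in> C" "Outer 1 \<in> C" "Outer 2 \<in> C" "Outer 3 \<in> C" "Outer 4 \<in> C"
      "Outer 5 \<in> C" "Outer 6 \<in> C"
      using S by auto
    have v1: "Inner 1 \<in> C" by (rule force[of "Outer 1"]) (use u0_6 in \<open>auto simp: arcs\<close>)
    have v2: "Inner 2 \<in> C" by (rule force[of "Outer 2"]) (use u0_6 in \<open>auto simp: arcs\<close>)
    have v3: "Inner 3 \<in> C" by (rule force[of "Outer 3"]) (use u0_6 in \<open>auto simp: arcs\<close>)
    have v4: "Inner 4 \<in> C" by (rule force[of "Outer 4"]) (use u0_6 in \<open>auto simp: arcs\<close>)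
    have v5: "Inner 5 \<in> C" by (rule force[of "Outer 5"]) (use u0_6 in \<open>auto simp: arcs\<close>)
    \<comment> \<open>The inner edges form three 4-cycles, one per residue modulo 3. In residues 1
      and 2 two adjacent vertices are now black, and each forces its other cycle neighbour.\<close>
    have v10: "Inner 10 \<in> C" by (rule force[of "Inner 1"]) (use u0_6 v1 v4 in \<open>auto simp: arcs\<close>)
    have v11: "Inner 11 \<in> C" by (rule force[of "Inner 2"]) (use u0_6 v2 v5 in \<open>auto simp: arcs\<close>)
    have v7: "Inner 7 \<in> C" by (rule force[of "Inner 4"]) (use u0_6 v1 v4 in \<open>auto simp: arcs\<close>)
    have v8: "Inner 8 \<in> C" by (rule force[of "Inner 5"]) (use u0_6 v2 v5 in \<open>auto simp: arcs\<close>)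
    \<comment> \<open>Those two cycles are now entirely black, so only the spokes to the outer cycle
      can still lead to white vertices.\<close>
    have u10: "Outer 10 \<in> C" by (rule force[of "Inner 10"]) (use v1 v7 v10 in \<open>auto simp: arcs\<close>)
    have u11: "Outer 11 \<in> C" by (rule force[of "Inner 11"]) (use v2 v8 v11 in \<open>auto simp: arcs\<close>)
    have u7: "Outer 7 \<in> C" by (rule force[of "Inner 7"]) (use v4 v7 v10 in \<open>auto simp: arcs\<close>)
    have u8: "Outer 8 \<in> C" by (rule force[of "Inner 8"]) (use v5 v8 v11 in \<open>auto simp: arcs\<close>)
    \<comment> \<open>The ends of the initial path can force only now that their outer neighbours
      \<open>Outer 11\<close> and \<open>Outer 7\<close> are black.\<close>
    have v0: "Inner 0 \<in> C" by (rule force[of "Outer 0"]) (use u0_6 u11 in \<open>auto simp: arcs\<close>)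
    have v6: "Inner 6 \<in> C" by (rule force[of "Outer 6"]) (use u0_6 u7 in \<open>auto simp: arcs\<close>)
    have u9: "Outer 9 \<in> C" by (rule force[of "Outer 8"]) (use u7 u8 v8 in \<open>auto simp: arcs\<close>)
    have v9: "Inner 9 \<in> C" by (rule force[of "Inner 6"]) (use u0_6 v3 v6 in \<open>auto simp: arcs\<close>)
    \<comment> \<open>Listing the indices splits the inclusion into the 24 memberships collected
      above.\<close>
    have "{..<12} = {0, 1, 2, 3, 4, 5, 6, 7, 8, 9, 10, 11 :: nat}"
      by (simp add: lessThan_nat_numeral lessThan_Suc insert_commute)
    thus "pverts ?G \<subseteq> C"
      using u0_6 u7 u8 u9 u10 u11 v0 v1 v2 v3 v4 v5 v6 v7 v8 v9 v10 v11
      by (simp add: verts)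
  qed
  moreover from this have "zero_forcing_number ?G \<le> card ?S"
    by (rule zero_forcing_number_le_card)
  ultimately show ?thesis by simp
qed

end
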